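(* Let $s\ge1$ and suppose that $(\hat U,\hat V)$ is a local solution (local minimizer) of the problem of minimizing $F_\lambda(U,V)$ over $(U,V)\in\mathcal{U}^{d\times s}\times\mathcal{V}^{d\times s}$. Put $\hat X=\hat U\hat V^T$ and $\mathcal{I}=\{j:\hat U_j\ne0\}$. Then there exists $\mu\in\mathbb{R}^d$ such that $$\left[\mu\mathbf{1}_{|\mathcal{I}|}^T-\nabla g(\hat X)\hat V_{\mathcal{I}}\right]_+=\lambda\,\hat U_{\mathcal{I}}\,\mathrm{diag}\left\{\frac{\|\hat V_j\|_2}{\|\hat U_j\|_2}\right\}_{j\in\mathcal{I}},$$ $$\left[\mathbf{1}_d\mu^T\hat U_{\mathcal{I}}-(\nabla g(\hat X))^T\hat U_{\mathcal{I}}\right]_+=\lambda\,\hat V_{\mathcal{I}}\,\mathrm{diag}\left\{\frac{\|\hat U_j\|_2}{\|\hat V_j\|_2}\right\}_{j\in\mathcal{I}}.$$ The vector $\mu$ satisfying these equations is unique if it exists (it is called the Lagrangian multiplier).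
   Context: Data: integers $d,n\ge1$ and a trajectory $(i_0,\dots,i_n)$ of states in $\{1,\dots,d\}$. Put $\hat\xi_j=\frac1n\#\{1\le t\le n: i_t=j\}$ and $\hat\Xi=\mathrm{diag}\{\hat\xi\}\in\mathbb{R}^{d\times d}$. Let $\hat P\in\mathbb{R}^{d\times d}$ be the empirical transition matrix: $\hat p_{ij}=\frac{\#\{1\le t\le n:\ i_{t-1}=i,\ i_t=j\}}{\#\{1\le t\le n:\ i_{t-1}=i\}}$ if the denominator is at least $1$, and $\hat p_{ij}=1/d$ otherwise. Define $g(X)=\frac12\|\hat\Xi(\hat P-X)\|_F^2$ for $X\in\mathbb{R}^{d\times d}$; $\nabla g$ is its gradient. The regularization parameter is $\lambda>0$. $\mathcal{U}^{d\times s}=\{U\in\mathbb{R}_+^{d\times s}:U\mathbf{1}_s=\mathbf{1}_d\}$ and $\mathcal{V}^{d\times s}=\{V\in\mathbb{R}_+^{d\times s}:V^T\mathbf{1}_d=\mathbf{1}_s\}$, where $\mathbb{R}_+^{p\times q}$ is the set of entrywise nonnegative matrices. The factorized objective is $F_\lambda(U,V)=g(UV^T)+\lambda\sum_{j=1}^s\|U_j\|_2\|V_j\|_2$. $A_j$ is the $j$-th column of $A$; $A_{\mathcal{I}}$ is the submatrix formed by the columns of $A$ indexed by $\mathcal{I}$; $[A]_+$ is the entrywise nonnegative part, $([A]_+)_{ij}=\max\{a_{ij},0\}$; $\mathbf{1}_p$ is the all-one vector in $\mathbb{R}^p$; $\mathrm{diag}\{x_j\}_{j\in\mathcal{I}}$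 is the diagonal matrix with diagonal entries $x_j$, $j\in\mathcal{I}$. *)

theory Defs
  imports "HOL-Analysis.Analysis"
begin

text \<open>
  The states and the factor indices are the elements of the finite types \<open>'d\<close> and \<open>'s\<close>, so that
  a $d \times s$ matrix has type \<open>real^'s^'d\<close>. The library norm and inner product on this type are
  the Frobenius ones, and \<open>1 :: real^'n\<close> is the all-one vector.
\<close>

section \<open>Matrices, gradients and local minimizers\<close>

definition outer :: "real^'m \<Rightarrow> real^'n \<Rightarrow> real^'n^'m" where
  "outer x y = (\<chi> i j. x $ i * y $ j)"

definition pos_part :: "real^'n^'m \<Rightarrow> real^'n^'m" where
  "pos_part A = (\<chi> i j. max (A $ i $ j) 0)"

text \<open>
  Vectors, column submatrices and diagonal matrices indexed by a subset \<open>I\<close> of the index type are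
  represented in the full size, with zeros at all positions outside \<open>I\<close>. Sums, products, scalar
  multiples and positive parts of such padded matrices are the padded versions of the corresponding
  results, and two padded matrices are equal iff the submatrices are.
\<close>

definition ones_on :: "'n set \<Rightarrow> real^'n" where
  "ones_on I = (\<chi> j. if j \<in> I then 1 else 0)"

definition cols_on :: "'n set \<Rightarrow> real^'n^'m \<Rightarrow> real^'n^'m" where
  "cols_on I A = (\<chi> i j. if j \<in> I then A $ i $ j else 0)"

definition diag_on :: "'n set \<Rightarrow> ('n \<Rightarrow> real) \<Rightarrow> real^'n^'n" where
  "diag_on I x = (\<chi> i j. if i = j \<and> j \<in> I then x j else 0)"

definition gradient :: "('a::real_inner \<Rightarrow> real) \<Rightarrow> 'a \<Rightarrow> 'a" where
  "gradient f x = (THE D. GDERIV f x :> D)"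

definition local_minimizer_on :: "('a::topological_space \<Rightarrow> real) \<Rightarrow> 'a set \<Rightarrow> 'a \<Rightarrow> bool" where
  "local_minimizer_on f S x \<longleftrightarrow> x \<in> S \<and> (\<forall>\<^sub>F y in at x within S. f x \<le> f y)"

section \<open>The estimation problem\<close>

text \<open>
  A trajectory $(i_0, \ldots, i_n)$ is given by a function \<open>w\<close> of which only the values
  \<open>w 0, \<dots>, w n\<close> are used.
\<close>

definition xi_hat :: "nat \<Rightarrow> (nat \<Rightarrow> 'd) \<Rightarrow> 'd \<Rightarrow> real" where
  "xi_hat n w j = real (card {t \<in> {1..n}. w t = j}) / real n"

definition Xi_hat :: "nat \<Rightarrow> (nat \<Rightarrow> 'd) \<Rightarrow> real^'d^'d" where
  "Xi_hat n w = diag_on UNIV (xi_hat n w)"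

definition P_hat :: "nat \<Rightarrow> (nat \<Rightarrow> 'd) \<Rightarrow> real^'d^'d" where
  "P_hat n w = (\<chi> i j.
     if card {t \<in> {1..n}. w (t - 1) = i} \<ge> 1
     then real (card {t \<in> {1..n}. w (t - 1) = i \<and> w t = j}) / real (card {t \<in> {1..n}. w (t - 1) = i})
     else 1 / real CARD('d))"

definition g_fun :: "nat \<Rightarrow> (nat \<Rightarrow> 'd::finite) \<Rightarrow> real^'d^'d \<Rightarrow> real" where
  "g_fun n w X = 1 / 2 * (norm (Xi_hat n w ** (P_hat n w - X)))\<^sup>2"

definition U_set :: "(real^'s^'d) set" where
  "U_set = {U. (\<forall>i j. U $ i $ j \<ge> 0) \<and> U *v 1 = 1}"

definition V_set :: "(real^'s^'d) set" where
  "V_set = {V. (\<forall>i j. V $ i $ j \<ge> 0) \<and> transpose V *v 1 = 1}"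

definition F_fun :: "nat \<Rightarrow> (nat \<Rightarrow> 'd::finite) \<Rightarrow> real \<Rightarrow> (real^'s::finite^'d) \<times> (real^'s^'d) \<Rightarrow> real" where
  "F_fun n w lam = (\<lambda>(U, V). g_fun n w (U ** transpose V)
     + lam * (\<Sum>j\<in>UNIV. norm (column j U) * norm (column j V)))"

end

theory Submission
  imports Defs
begin

text \<open>
  A row of $\hat U$ stays stochastic when mass is moved from a positive entry to another entry. If both
  entries lie in nonzero columns, the objective is differentiable along this move, and local
  minimality says that the partial derivatives $(\nabla g(\hat X) \hat V)_{ij} + \lambda
  \hat u_{ij} \|\hat V_j\| / \|\hat U_j\|$ of row $i$ are minimal, with common value $\mu_i$,
  at the positive entries; this is the first equation. In the same way each column $j$ of $\hat V$
  gets a multiplier $\nu_j$. Pairing the two stationarity conditions with $\hat U_j$ and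
  $\hat V_j$ gives $\mu^T \hat U_j = \hat U_j^T \nabla g(\hat X) \hat V_j +
  \lambda \|\hat U_j\| \|\hat V_j\| = \nu_j$, hence the second equation. Every row of $\hat U$ has a
  positive entry, and there the first equation determines $\mu_i$.
\<close>

section \<open>Gradients and adjoints for the Frobenius inner product\<close>

lemma GDERIV_unique:
  assumes "GDERIV f x :> D" "GDERIV f x :> E"
  shows "D = E"
proof -
  have "(\<lambda>h. inner h D) = (\<lambda>h. inner h E)"
    using assms unfolding gderiv_def by (rule has_derivative_unique)
  then have "inner (D - E) D = inner (D - E) E"
    by (rule fun_cong)
  then have "inner (D - E) (D - E) = 0"
    by (simp add: inner_diff_right)
  then show ?thesis
    by simp
qed

text \<open>Justifies the definite description in \<open>gradient\<close>: the Riesz representative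
  of the derivative exists and is unique.\<close>

lemma GDERIV_gradient:
  fixes f :: "'a::euclidean_space \<Rightarrow> real"
  assumes "f differentiable at x"
  shows "GDERIV f x :> gradient f x"
proof -
  obtain f' where f': "(f has_derivative f') (at x)"
    using assms by (auto simp: differentiable_def)
  \<comment> \<open>The representative is the adjoint of \<open>f'\<close> applied to the real
    number 1.\<close>
  have "inner h (adjoint f' 1) = f' h" for h
    using adjoint_works[OF has_derivative_linear[OF f'], of h 1] by simp
  then have "GDERIV f x :> adjoint f' 1"
    using f' by (simp add: gderiv_def)
  then show ?thesis
    unfolding gradient_def by (rule theI) (rule GDERIV_unique[OF _ \<open>GDERIV f x :> adjoint f' 1\<close>])
qed

lemma inner_matrix: "inner A B = (\<Sum>i\<in>UNIV. \<Sum>j\<in>UNIV. A $ i $ j * B $ i $ j)"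
  for A B :: "real^'n^'m"
  by (simp add: inner_vec_def)

lemma inner_transpose: "inner (transpose A) B = inner A (transpose B)"
  for A :: "real^'n^'m" and B :: "real^'m^'n"
  unfolding inner_matrix transpose_def by (simp, rule sum.swap)

text \<open>Right multiplications by \<open>transpose B\<close> and by \<open>B\<close> are adjoint.
  This turns the directional derivative of \<open>f (X ** transpose Y)\<close> into a pairing with
  the matrix \<open>G ** Y\<close>.\<close>

lemma inner_matrix_mult_transpose: "inner (A ** transpose B) C = inner A (C ** B)"
  for A :: "real^'n^'m" and B :: "real^'n^'k" and C :: "real^'k^'m"
  unfolding inner_matrix matrix_matrix_mult_def transpose_def
  by (auto simp: sum_distrib_left sum_distrib_right mult_ac intro!: sum.cong intro: sum.swap trans)

lemma linear_transpose: "linear (transpose :: real^'n^'m \<Rightarrow> real^'m^'n)"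
  by (rule linearI) (simp_all add: transpose_def vec_eq_iff)

lemma linear_matrix_mult_left: "linear (\<lambda>X :: real^'n^'m. (A :: real^'m^'k) ** X)"
  by (rule linearI) (simp_all add: matrix_add_ldistrib matrix_scalar_ac scalar_matrix_assoc)

text \<open>Prepares the exchange of the two factors: \<open>V ** transpose U\<close> is the
  transpose of \<open>U ** transpose V\<close>.\<close>

lemma GDERIV_compose_transpose:
  fixes f :: "real^'n^'m \<Rightarrow> real"
  assumes "GDERIV f (transpose X) :> D"
  shows "GDERIV (f \<circ> transpose) X :> transpose D"
proof -
  have "(transpose has_derivative (transpose :: real^'m^'n \<Rightarrow> real^'n^'m)) (at X)"
    using linear_transpose by (intro bounded_linear_imp_has_derivative) (simp add: linear_conv_bounded_linear)
  from diff_chain_at[OF this assms[unfolded gderiv_def]] show ?thesis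
    by (simp add: gderiv_def comp_def inner_transpose)
qed

lemma g_fun_differentiable: "g_fun n w differentiable at X"
proof -
  have "(\<lambda>X. Xi_hat n w ** (P_hat n w - X)) differentiable at X"
    unfolding linear_diff[OF linear_matrix_mult_left]
    by (intro differentiable_diff differentiable_const linear_imp_differentiable linear_matrix_mult_left)
  then have "(\<lambda>X. (1 / 2) *\<^sub>R inner (Xi_hat n w ** (P_hat n w - X)) (Xi_hat n w ** (P_hat n w - X)))
      differentiable at X"
    by (intro differentiable_scaleR differentiable_inner differentiable_const)
  then show ?thesis
    by (simp add: g_fun_def[abs_def] power2_norm_eq_inner)
qed

section \<open>Directional derivatives of the objective in one factor\<close>

lemma DERIV_norm_line:
  fixes u e :: "'a::real_inner"
  assumes "u = 0 \<Longrightarrow> e = 0"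
  shows "((\<lambda>t. norm (u + t *\<^sub>R e)) has_real_derivative inner e u / norm u) (at 0)"
proof (cases "u = 0")
  case False
  then have "((\<lambda>t. norm (u + t *\<^sub>R e)) has_derivative (\<lambda>t. inner (t *\<^sub>R e) (sgn u))) (at 0)"
    by (intro has_derivative_compose[where f = "\<lambda>t. u + t *\<^sub>R e" and g = norm])
       (auto intro!: derivative_eq_intros simp: has_derivative_norm)
  then show ?thesis
    by (rule has_derivative_imp_has_field_derivative)
       (simp add: sgn_div_norm divide_inverse mult_ac)
\<comment> \<open>At \<open>u = 0\<close> the direction vanishes as well, so the norm is constantly
  0, and the claimed derivative \<open>0 / 0\<close> is 0 by convention.\<close>
qed (use assms in simp)

text \<open>The partial derivatives of the objective in the factor \<open>X\<close> with
  \<open>Y\<close> fixed. In a zero column of \<open>X\<close> the penalty term takes the default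
  value 0 and is no genuine derivative.\<close>

definition partials :: "real \<Rightarrow> real^'d^'m \<Rightarrow> real^'s^'m \<Rightarrow> real^'s^'d \<Rightarrow> real^'s^'m" where
  "partials lam G X Y = G ** Y
     + lam *\<^sub>R (\<chi> i j. X $ i $ j * (norm (column j Y) / norm (column j X)))"

text \<open>The row type of \<open>X\<close> is left general and \<open>f\<close> is arbitrary, so
  that one computation serves both factors. The condition on \<open>E\<close> keeps zero columns at
  zero, away from the kink of the norm.\<close>

lemma DERIV_objective_line:
  fixes X E :: "real^'s^'m" and Y :: "real^'s^'d" and f :: "real^'d^'m \<Rightarrow> real"
  assumes f: "GDERIV f (X ** transpose Y) :> G"
    and E: "\<And>j. column j X = 0 \<Longrightarrow> column j E = 0"
  shows "((\<lambda>t. f ((X + t *\<^sub>R E) ** transpose Y)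
      + lam * (\<Sum>j\<in>UNIV. norm (column j (X + t *\<^sub>R E)) * norm (column j Y)))
    has_real_derivative inner E (partials lam G X Y)) (at 0)"
proof -
  have line: "(X + t *\<^sub>R E) ** transpose Y = X ** transpose Y + t *\<^sub>R (E ** transpose Y)" for t
    by (simp add: vec_eq_iff matrix_matrix_mult_def algebra_simps sum.distrib sum_distrib_left)
  have "((\<lambda>t. f (X ** transpose Y + t *\<^sub>R (E ** transpose Y))) has_derivative
      (\<lambda>t. inner (t *\<^sub>R (E ** transpose Y)) G)) (at 0)"
    using f unfolding gderiv_def
    by (intro has_derivative_compose[where f = "\<lambda>t. X ** transpose Y + t *\<^sub>R (E ** transpose Y)" and g = f])
       (auto intro!: derivative_eq_intros)
  then have smooth: "((\<lambda>t. f ((X + t *\<^sub>R E) ** transpose Y)) has_real_derivative inner E (G ** Y)) (at 0)"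
    unfolding line
    by (rule has_derivative_imp_has_field_derivative) (simp add: inner_matrix_mult_transpose)
  have col: "column j (X + t *\<^sub>R E) = column j X + t *\<^sub>R column j E" for j t
    by (simp add: column_def vec_eq_iff)
  have "((\<lambda>t. norm (column j (X + t *\<^sub>R E))) has_real_derivative
      inner (column j E) (column j X) / norm (column j X)) (at 0)" for j
    unfolding col by (rule DERIV_norm_line) (rule E)
  then have "((\<lambda>t. f ((X + t *\<^sub>R E) ** transpose Y)
      + lam * (\<Sum>j\<in>UNIV. norm (column j (X + t *\<^sub>R E)) * norm (column j Y)))
    has_real_derivative inner E (G ** Y) + lam * (\<Sum>j\<in>UNIV.
      inner (column j E) (column j X) / norm (column j X) * norm (column j Y))) (at 0)"
    by (intro DERIV_add smooth DERIV_cmult DERIV_sum DERIV_cmult_right)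
  \<comment> \<open>Summation by columns is exchanged for summation by rows, to present the penalty
    derivative as a Frobenius pairing with \<open>E\<close>.\<close>
  moreover have "(\<Sum>j\<in>UNIV. inner (column j E) (column j X) / norm (column j X) * norm (column j Y))
      = inner E (\<chi> i j. X $ i $ j * (norm (column j Y) / norm (column j X)))"
    unfolding inner_matrix
    by (subst sum.swap)
       (simp add: inner_vec_def column_def sum_distrib_left sum_distrib_right sum_divide_distrib mult_ac)
  ultimately show ?thesis
    by (simp add: partials_def inner_add_right)
qed

section \<open>First-order minimality along feasible rays and mass transfers\<close>

lemma DERIV_nonneg_if_right_minimal:
  fixes \<phi> :: "real \<Rightarrow> real"
  assumes "(\<phi> has_real_derivative D) (at 0)" and "\<forall>\<^sub>F t in at_right 0. \<phi> 0 \<le> \<phi> t"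
  shows "0 \<le> D"
proof (rule ccontr)
  assume "\<not> 0 \<le> D"
  then obtain d where "d > 0" and d: "\<And>h. 0 < h \<Longrightarrow> h < d \<Longrightarrow> \<phi> h < \<phi> 0"
    using has_real_derivative_neg_dec_right[OF assms(1)] by auto
  have "\<forall>\<^sub>F t in at_right 0. t \<in> {0<..<d}"
    using \<open>d > 0\<close> by (rule eventually_at_right_real)
  with assms(2) have "\<forall>\<^sub>F t in at_right (0::real). False"
    by eventually_elim (use d in force)
  then show False
    by simp
qed

lemma local_minimizer_on_line:
  fixes x e :: "'a::real_normed_vector"
  assumes "local_minimizer_on f S x" and "\<forall>\<^sub>F t in at_right 0. x + t *\<^sub>R e \<in> S"
  shows "\<forall>\<^sub>F t in at_right 0. f x \<le> f (x + t *\<^sub>R e)"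
proof -
  obtain d where "d > 0" and d: "\<And>y. y \<in> S \<Longrightarrow> y \<noteq> x \<Longrightarrow> dist y x < d \<Longrightarrow> f x \<le> f y"
    using assms(1) unfolding local_minimizer_on_def eventually_at by blast
  have "((\<lambda>t. x + t *\<^sub>R e) \<longlongrightarrow> x + 0 *\<^sub>R e) (at_right 0)"
    by (intro tendsto_intros)
  then have "\<forall>\<^sub>F t in at_right 0. dist (x + t *\<^sub>R e) x < d"
    using \<open>d > 0\<close> by (simp add: tendsto_iff)
  with assms(2) show ?thesis
    \<comment> \<open>The neighbourhood is punctured; if the point on the ray equals
      \<open>x\<close>, the inequality is an equality.\<close>
    by eventually_elim (use d in force)
qed

text \<open>The direction taking mass from entry \<open>(a, b)\<close> to entry
  \<open>(c, d)\<close>. Four indices cover both transfers within a row of \<open>U\<close> and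
  transfers within a column of \<open>V\<close>.\<close>

definition move :: "'m \<Rightarrow> 'n \<Rightarrow> 'm \<Rightarrow> 'n \<Rightarrow> real^'n^'m" where
  "move a b c d = axis c (axis d 1) - axis a (axis b 1)"

text \<open>The derivative along the move is the receiver's partial minus the donor's, and
  minimality makes it nonnegative. Both affected columns are nonzero, the donor's because of its
  positive entry, so the objective is differentiable along the move.\<close>

lemma partials_le_if_move_minimal:
  fixes X :: "real^'s^'m" and Y :: "real^'s^'d" and f :: "real^'d^'m \<Rightarrow> real"
  assumes f: "GDERIV f (X ** transpose Y) :> G"
    and "X $ a $ b > 0" and "column d X \<noteq> 0"
    and min: "\<forall>\<^sub>F t in at_right 0. f (X ** transpose Y)
        + lam * (\<Sum>j\<in>UNIV. norm (column j X) * norm (column j Y))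
      \<le> f ((X + t *\<^sub>R move a b c d) ** transpose Y)
        + lam * (\<Sum>j\<in>UNIV. norm (column j (X + t *\<^sub>R move a b c d)) * norm (column j Y))"
  shows "partials lam G X Y $ a $ b \<le> partials lam G X Y $ c $ d"
proof -
  have "column b X \<noteq> 0"
    using \<open>X $ a $ b > 0\<close> by (auto simp: column_def vec_eq_iff intro!: exI[of _ a])
  then have "column j (move a b c d :: real^'s^'m) = 0" if "column j X = 0" for j
    using that \<open>column d X \<noteq> 0\<close> by (auto simp: move_def column_def vec_eq_iff axis_def)
  from DERIV_objective_line[OF f this]
  have "0 \<le> inner (move a b c d) (partials lam G X Y)"
    by (rule DERIV_nonneg_if_right_minimal) (use min in simp_all)
  then show ?thesis
    by (simp add: move_def inner_diff_left inner_axis')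
qed

lemma move_nonneg:
  fixes X :: "real^'n^'m"
  assumes "\<forall>i j. X $ i $ j \<ge> 0" and "0 < t" and "t < X $ a $ b"
  shows "(X + t *\<^sub>R move a b c d) $ i $ j \<ge> 0"
proof -
  have "X $ i $ j \<ge> 0"
    using assms(1) by simp
  then show ?thesis
    using assms(2,3) by (auto simp: move_def axis_def)
qed

lemma move_in_U_set:
  assumes "U \<in> U_set" and "0 < t" and "t < U $ i $ j"
  shows "U + t *\<^sub>R move i j i k \<in> U_set"
proof -
  have "(\<Sum>l\<in>UNIV. move i j i k $ r $ l) = 0" for r :: 'b
    by (simp add: move_def axis_def sum_subtractf)
  then have "(U + t *\<^sub>R move i j i k) *v 1 = U *v 1"
    by (simp add: matrix_vector_mult_def vec_eq_iff sum.distrib flip: sum_distrib_left)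
  then show ?thesis
    using assms move_nonneg[of U t i j i k] by (auto simp: U_set_def)
qed

lemma move_in_V_set:
  assumes "V \<in> V_set" and "0 < t" and "t < V $ i $ j"
  shows "V + t *\<^sub>R move i j k j \<in> V_set"
proof -
  have "(\<Sum>r\<in>UNIV. move i j k j $ r $ l) = 0" for l :: 'a
    by (simp add: move_def axis_def sum_subtractf if_distrib[of "\<lambda>v. v $ l"] cong: if_cong)
  then have "transpose (V + t *\<^sub>R move i j k j) *v 1 = transpose V *v 1"
    by (simp add: matrix_vector_mult_def transpose_def vec_eq_iff sum.distrib flip: sum_distrib_left)
  then show ?thesis
    using assms move_nonneg[of V t i j k j] by (auto simp: V_set_def)
qed

lemma U_stationary:
  fixes U V :: "real^'s^'d"
  assumes min: "local_minimizer_on (F_fun n w lam) (U_set \<times> V_set) (U, V)"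
    and "U $ i $ j > 0" and "column k U \<noteq> 0"
  defines "G \<equiv> gradient (g_fun n w) (U ** transpose V)"
  shows "partials lam G U V $ i $ j \<le> partials lam G U V $ i $ k"
proof (rule partials_le_if_move_minimal[OF _ assms(2,3)])
  show "GDERIV (g_fun n w) (U ** transpose V) :> G"
    unfolding G_def by (rule GDERIV_gradient) (rule g_fun_differentiable)
  have "U \<in> U_set" "V \<in> V_set"
    using min by (auto simp: local_minimizer_on_def)
  have "\<forall>\<^sub>F t in at_right 0. t \<in> {0<..<U $ i $ j}"
    using assms(2) by (rule eventually_at_right_real)
  then have "\<forall>\<^sub>F t in at_right 0. (U, V) + t *\<^sub>R (move i j i k, 0) \<in> U_set \<times> V_set"
    by eventually_elim (use \<open>U \<in> U_set\<close> \<open>V \<in> V_set\<close> move_in_U_set in auto)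
  from local_minimizer_on_line[OF min this]
  show "\<forall>\<^sub>F t in at_right 0. g_fun n w (U ** transpose V)
        + lam * (\<Sum>j\<in>UNIV. norm (column j U) * norm (column j V))
      \<le> g_fun n w ((U + t *\<^sub>R move i j i k) ** transpose V)
        + lam * (\<Sum>l\<in>UNIV. norm (column l (U + t *\<^sub>R move i j i k)) * norm (column l V))"
    by (simp add: F_fun_def)
qed

text \<open>The general criterion applied to \<open>g_fun n w \<circ> transpose\<close> with the
  factors exchanged, whence the transposed gradient. The receiving entry lies in the donor's column,
  which is nonzero.\<close>

lemma V_stationary:
  fixes U V :: "real^'s^'d"
  assumes min: "local_minimizer_on (F_fun n w lam) (U_set \<times> V_set) (U, V)"
    and "V $ i $ j > 0"
  defines "G \<equiv> gradient (g_fun n w) (U ** transpose V)"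
  shows "partials lam (transpose G) V U $ i $ j \<le> partials lam (transpose G) V U $ k $ j"
proof (rule partials_le_if_move_minimal[OF _ assms(2)])
  have tr: "transpose (A ** transpose B) = B ** transpose A" for A B :: "real^'s^'d"
    by (simp add: matrix_transpose_mul)
  show "GDERIV (g_fun n w \<circ> transpose) (V ** transpose U) :> transpose G"
    unfolding G_def
    by (rule GDERIV_compose_transpose) (simp add: tr GDERIV_gradient g_fun_differentiable)
  show "column j V \<noteq> 0"
    using assms(2) by (auto simp: column_def vec_eq_iff intro!: exI[of _ i])
  have "U \<in> U_set" "V \<in> V_set"
    using min by (auto simp: local_minimizer_on_def)
  have "\<forall>\<^sub>F t in at_right 0. t \<in> {0<..<V $ i $ j}"
    using assms(2) by (rule eventually_at_right_real)
  then have "\<forall>\<^sub>F t in at_right 0. (U, V) + t *\<^sub>R (0, move i j k j) \<in> U_set \<times> V_set"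
    by eventually_elim (use \<open>U \<in> U_set\<close> \<open>V \<in> V_set\<close> move_in_V_set in auto)
  from local_minimizer_on_line[OF min this]
  show "\<forall>\<^sub>F t in at_right 0. (g_fun n w \<circ> transpose) (V ** transpose U)
        + lam * (\<Sum>j\<in>UNIV. norm (column j V) * norm (column j U))
      \<le> (g_fun n w \<circ> transpose) ((V + t *\<^sub>R move i j k j) ** transpose U)
        + lam * (\<Sum>l\<in>UNIV. norm (column l (V + t *\<^sub>R move i j k j)) * norm (column l U))"
    by (simp add: F_fun_def tr mult.commute[of "norm (column _ U)"])
qed

section \<open>Multipliers from stationarity inequalities\<close>

lemma multiplier_exists:
  fixes x a c :: "'k \<Rightarrow> real"
  assumes "\<And>k. k \<in> K \<Longrightarrow> x k \<ge> 0" and "\<And>k. k \<in> K \<Longrightarrow> c k \<ge> 0"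
    and "j \<in> K" and "x j > 0"
    and stat: "\<And>k l. k \<in> K \<Longrightarrow> l \<in> K \<Longrightarrow> x k > 0 \<Longrightarrow> a k + c k * x k \<le> a l + c l * x l"
  obtains \<nu> where "\<And>k. k \<in> K \<Longrightarrow> max (\<nu> - a k) 0 = c k * x k"
    "\<And>k. k \<in> K \<Longrightarrow> \<nu> * x k = (a k + c k * x k) * x k"
proof
  fix k
  assume k: "k \<in> K"
  have le: "a j + c j * x j \<le> a k + c k * x k"
    using stat[OF \<open>j \<in> K\<close> k \<open>x j > 0\<close>] .
  have eq: "a j + c j * x j = a k + c k * x k" if "x k > 0"
    using le stat[OF k \<open>j \<in> K\<close> that] by simp
  \<comment> \<open>The multiplier is the value at \<open>j\<close>, which is minimal over
    \<open>K\<close>. Where \<open>x k > 0\<close> it equals the value at \<open>k\<close>; where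
    \<open>x k = 0\<close> it is at most \<open>a k\<close>, so the positive part vanishes.\<close>
  show "max (a j + c j * x j - a k) 0 = c k * x k"
    using le eq assms(1,2)[OF k] by (cases "x k = 0") auto
  \<comment> \<open>The factor \<open>x k\<close> extends the equality to the zero entries, which
    allows summation over all indices later.\<close>
  show "(a j + c j * x j) * x k = (a k + c k * x k) * x k"
    using eq assms(1)[OF k] by (cases "x k = 0") auto
qed

lemma max_eq_pos_unique:
  fixes a b c m :: real
  assumes "max (a - m) 0 = c" and "max (b - m) 0 = c" and "c > 0"
  shows "a = b"
  using assms by (auto simp: max_def split: if_splits)

section \<open>Entrywise form of the padded matrix equations\<close>

lemma mult_cols_on: "(A ** cols_on I B) $ i $ j = (if j \<in> I then (A ** B) $ i $ j else 0)"
  by (simp add: cols_on_def matrix_matrix_mult_def)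

lemma cols_on_mult_diag_on:
  "(cols_on I A ** diag_on I x) $ i $ j = (if j \<in> I then A $ i $ j * x j else 0)"
proof -
  have "(cols_on I A ** diag_on I x) $ i $ j
      = (\<Sum>k\<in>UNIV. if k = j then (if j \<in> I then A $ i $ j * x j else 0) else 0)"
    unfolding cols_on_def diag_on_def matrix_matrix_mult_def
    by (simp only: vec_lambda_beta) (intro sum.cong refl, simp)
  also have "\<dots> = (if j \<in> I then A $ i $ j * x j else 0)"
    by (rule sum.delta[THEN trans]) simp_all
  finally show ?thesis .
qed

lemma outer_1_mult: "(outer 1 \<mu> ** A) $ i $ j = inner \<mu> (column j A)"
  by (simp add: outer_def matrix_matrix_mult_def inner_vec_def column_def)

text \<open>In columns outside \<open>I\<close> the padding makes both sides zero, so only the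
  columns in \<open>I\<close> carry a condition.\<close>

lemma multiplier_equation_rows:
  fixes U V :: "real^'s^'d" and G :: "real^'d^'d"
  shows "pos_part (outer \<mu> (ones_on I) - G ** cols_on I V) = lam *\<^sub>R (cols_on I U ** diag_on I x)
    \<longleftrightarrow> (\<forall>i. \<forall>j\<in>I. max (\<mu> $ i - (G ** V) $ i $ j) 0 = lam * (U $ i $ j * x j))"
  by (auto simp: vec_eq_iff pos_part_def mult_cols_on cols_on_mult_diag_on outer_def ones_on_def)

lemma multiplier_equation_cols:
  fixes U V :: "real^'s^'d" and G :: "real^'d^'d"
  shows "pos_part (outer 1 \<mu> ** cols_on I U - G ** cols_on I U) = lam *\<^sub>R (cols_on I V ** diag_on I x)
    \<longleftrightarrow> (\<forall>i. \<forall>j\<in>I. max (inner \<mu> (column j U) - (G ** U) $ i $ j) 0 = lam * (V $ i $ j * x j))"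
  by (auto simp: vec_eq_iff pos_part_def mult_cols_on cols_on_mult_diag_on outer_1_mult)

theorem theorem4p2:
  fixes n :: nat and w :: "nat \<Rightarrow> 'd::finite" and lam :: real
    and U V :: "real^'s::finite^'d"
  assumes "n \<ge> 1" and "lam > 0"
    and "local_minimizer_on (F_fun n w lam) (U_set \<times> V_set) (U, V)"
  defines "G \<equiv> gradient (g_fun n w) (U ** transpose V)"
    and "I \<equiv> {j. column j U \<noteq> 0}"
  shows "\<exists>!\<mu> :: real^'d.
    pos_part (outer \<mu> (ones_on I) - G ** cols_on I V)
      = lam *\<^sub>R (cols_on I U ** diag_on I (\<lambda>j. norm (column j V) / norm (column j U)))
    \<and> pos_part (outer 1 \<mu> ** cols_on I U - transpose G ** cols_on I U)
      = lam *\<^sub>R (cols_on I V ** diag_on I (\<lambda>j. norm (column j U) / norm (column j V)))"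
  unfolding multiplier_equation_rows multiplier_equation_cols
proof -
  let ?u = "\<lambda>j. norm (column j U)" and ?v = "\<lambda>j. norm (column j V)"
  have U: "U $ i $ j \<ge> 0" "(\<Sum>j\<in>UNIV. U $ i $ j) = 1"
    and V: "V $ i $ j \<ge> 0" "(\<Sum>i\<in>UNIV. V $ i $ j) = 1" for i j
    using assms(3) by (auto simp: local_minimizer_on_def U_set_def V_set_def
        matrix_vector_mult_def transpose_def vec_eq_iff)
  have U_pos: "\<exists>j\<in>I. U $ i $ j > 0" for i
  proof -
    obtain j where "U $ i $ j \<noteq> 0"
      using U(2)[of i] by (metis sum.neutral zero_neq_one)
    then show ?thesis
      using U(1)[of i j] by (auto simp: I_def column_def vec_eq_iff intro!: bexI[of _ j])
  qed
  have V_pos: "\<exists>i. V $ i $ j > 0" for j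
    using V by (metis less_eq_real_def sum.neutral zero_neq_one)
  have u_nz: "?u j \<noteq> 0" if "j \<in> I" for j
    using that by (simp add: I_def)
  \<comment> \<open>Every column of \<open>V\<close> sums to 1, so this holds for all
    \<open>j\<close>, not only for those in \<open>I\<close>.\<close>
  have v_nz: "?v j \<noteq> 0" for j
    using V_pos[of j] by (force simp: column_def vec_eq_iff)

  \<comment> \<open>Each row \<open>i\<close> of \<open>U\<close> gets its own multiplier; the
    second conjunct is kept for the pairing with \<open>column j U\<close> below.\<close>
  have "\<exists>m. \<forall>j\<in>I. max (m - (G ** V) $ i $ j) 0 = lam * (?v j / ?u j) * U $ i $ j
      \<and> m * U $ i $ j = ((G ** V) $ i $ j + lam * (?v j / ?u j) * U $ i $ j) * U $ i $ j" for i
  proof -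
    obtain j where j: "j \<in> I" "U $ i $ j > 0"
      using U_pos by blast
    have "(G ** V) $ i $ k + lam * (?v k / ?u k) * U $ i $ k
        \<le> (G ** V) $ i $ l + lam * (?v l / ?u l) * U $ i $ l" if "l \<in> I" "U $ i $ k > 0" for k l
      using U_stationary[OF assms(3) that(2), of l] that(1)
      by (simp add: partials_def G_def I_def mult_ac)
    then show ?thesis
      by (rule multiplier_exists[of I "\<lambda>j. U $ i $ j" "\<lambda>j. lam * (?v j / ?u j)" j "\<lambda>j. (G ** V) $ i $ j",
            rotated 4]) (use j U \<open>lam > 0\<close> in auto)
  qed
  then obtain m where m: "\<And>i j. j \<in> I \<Longrightarrow>
      max (m i - (G ** V) $ i $ j) 0 = lam * (?v j / ?u j) * U $ i $ j"
    and m_U: "\<And>i j. j \<in> I \<Longrightarrow>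
      m i * U $ i $ j = ((G ** V) $ i $ j + lam * (?v j / ?u j) * U $ i $ j) * U $ i $ j"
    by metis
  define \<mu> where "\<mu> = (\<chi> i. m i)"

  have cols: "max (inner \<mu> (column j U) - (transpose G ** U) $ i $ j) 0
      = lam * (?u j / ?v j) * V $ i $ j" if "j \<in> I" for i j
  proof -
    have stat: "(transpose G ** U) $ k $ j + lam * (?u j / ?v j) * V $ k $ j
        \<le> (transpose G ** U) $ l $ j + lam * (?u j / ?v j) * V $ l $ j" if "V $ k $ j > 0" for k l
      using V_stationary[OF assms(3) that, of l] by (simp add: partials_def G_def mult_ac)
    \<comment> \<open>Column \<open>j\<close> of \<open>V\<close> first gets an independent
      multiplier \<open>\<nu>\<close>, which the chain of equations then identifies with
      \<open>inner \<mu> (column j U)\<close>.\<close>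
    obtain i0 where "V $ i0 $ j > 0"
      using V_pos by blast
    then obtain \<nu> where \<nu>: "\<And>i. max (\<nu> - (transpose G ** U) $ i $ j) 0 = lam * (?u j / ?v j) * V $ i $ j"
      and \<nu>_V: "\<And>i. \<nu> * V $ i $ j
        = ((transpose G ** U) $ i $ j + lam * (?u j / ?v j) * V $ i $ j) * V $ i $ j"
      using multiplier_exists[of UNIV "\<lambda>i. V $ i $ j" "\<lambda>_. lam * (?u j / ?v j)" i0
          "\<lambda>i. (transpose G ** U) $ i $ j"] stat V \<open>lam > 0\<close> by auto
    have sq: "(\<Sum>i\<in>UNIV. A $ i $ j * A $ i $ j) = norm (column j A) * norm (column j A)"
      for A :: "real^'s^'d"
      by (simp add: column_def inner_vec_def power2_norm_eq_inner flip: power2_eq_square[of "norm _"])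
    \<comment> \<open>Column \<open>j\<close> of \<open>V\<close> has sum 1, so \<open>\<nu>\<close>
      is its own weighted average and stationarity can be inserted under the sum.\<close>
    have "\<nu> = (\<Sum>i\<in>UNIV. \<nu> * V $ i $ j)"
      by (simp add: V flip: sum_distrib_left)
    also have "\<dots> = (\<Sum>i\<in>UNIV. (transpose G ** U) $ i $ j * V $ i $ j)
        + lam * (?u j / ?v j) * (\<Sum>i\<in>UNIV. V $ i $ j * V $ i $ j)"
      by (simp add: \<nu>_V algebra_simps sum.distrib sum_distrib_left)
    also have "\<dots> = (\<Sum>i\<in>UNIV. (transpose G ** U) $ i $ j * V $ i $ j) + lam * ?u j * ?v j"
      using v_nz[of j] by (simp add: sq)
    \<comment> \<open>Both sums are the bilinear form of \<open>G\<close> at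
      \<open>column j U\<close> and \<open>column j V\<close>.\<close>
    also have "(\<Sum>i\<in>UNIV. (transpose G ** U) $ i $ j * V $ i $ j)
        = (\<Sum>i\<in>UNIV. (G ** V) $ i $ j * U $ i $ j)"
      unfolding matrix_matrix_mult_def transpose_def
      by (simp add: sum_distrib_right, subst sum.swap, simp add: mult_ac)
    \<comment> \<open>The symmetric term \<open>lam * ?u j * ?v j\<close> is expanded again, now as
      the penalty derivative on the \<open>U\<close> side, so that \<open>m_U\<close>
      applies.\<close>
    also have "(\<Sum>i\<in>UNIV. (G ** V) $ i $ j * U $ i $ j) + lam * ?u j * ?v j
        = (\<Sum>i\<in>UNIV. (G ** V) $ i $ j * U $ i $ j)
        + lam * (?v j / ?u j) * (\<Sum>i\<in>UNIV. U $ i $ j * U $ i $ j)"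
      using u_nz[OF that] by (simp add: sq)
    also have "\<dots> = (\<Sum>i\<in>UNIV. m i * U $ i $ j)"
      by (simp add: m_U[OF that] algebra_simps sum.distrib sum_distrib_left)
    also have "\<dots> = inner \<mu> (column j U)"
      by (simp add: \<mu>_def inner_vec_def column_def)
    finally show ?thesis
      using \<nu> by simp
  qed

  have unique: "\<mu>1 = \<mu>2"
    if 1: "\<forall>i. \<forall>j\<in>I. max (\<mu>1 $ i - (G ** V) $ i $ j) 0 = lam * (U $ i $ j * (?v j / ?u j))"
      and 2: "\<forall>i. \<forall>j\<in>I. max (\<mu>2 $ i - (G ** V) $ i $ j) 0 = lam * (U $ i $ j * (?v j / ?u j))"
    for \<mu>1 \<mu>2 :: "real^'d"
  proof -
    have "\<mu>1 $ i = \<mu>2 $ i" for i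
    proof -
      obtain j where "j \<in> I" "U $ i $ j > 0"
        using U_pos by blast
      \<comment> \<open>A positive right-hand side forces the positive part to be its argument,
        which fixes the multiplier's entry \<open>i\<close>.\<close>
      then have "lam * (U $ i $ j * (?v j / ?u j)) > 0"
        using \<open>lam > 0\<close> u_nz v_nz[of j] by simp
      then show ?thesis
        using 1 2 \<open>j \<in> I\<close> max_eq_pos_unique by blast
    qed
    then show ?thesis
      by (simp add: vec_eq_iff)
  qed

  show "\<exists>!\<mu>. (\<forall>i. \<forall>j\<in>I. max (\<mu> $ i - (G ** V) $ i $ j) 0 = lam * (U $ i $ j * (?v j / ?u j)))
    \<and> (\<forall>i. \<forall>j\<in>I. max (inner \<mu> (column j U) - (transpose G ** U) $ i $ j) 0
        = lam * (V $ i $ j * (?u j / ?v j)))"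
    by (rule ex1I[of _ \<mu>]) (use m cols unique in \<open>auto simp: \<mu>_def mult_ac\<close>)
qed

end
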